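(* For each $r\in(\alpha_0,\beta_0)$ and $x\in[-1,1]$, let $u_{\varepsilon r}(x):=z_{\varepsilon r}(x/\varepsilon)$ and $u^R_{\varepsilon r}(x):=u_{\varepsilon r}(-x)$, where $z_{\varepsilon r}$ is the Maxwell solution (defined for all sufficiently small $\varepsilon>0$). Then $$\lim_{\varepsilon\to0^+}u_{\varepsilon r}(x)=u_0(x)\quad\text{if } x\neq-1+\ell_1,\qquad\qquad \lim_{\varepsilon\to0^+}u^R_{\varepsilon r}(x)=u_0(-x)\quad\text{if } x\neq-1+\ell_2,$$ where $$\ell_1:=\frac{2(\beta_0-r)}{\beta_0-\alpha_0},\qquad \ell_2:=\frac{2(r-\alpha_0)}{\beta_0-\alpha_0},\qquad u_0(x):=\begin{cases}\alpha_0, & -1\le x\le-1+\ell_1,\\ \beta_0, & -1+\ell_1<x\le1.\end{cases}$$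
   Context: $Q(s)=\sqrt{1+s^2}-1$. Fix $0<\overline\alpha<\underline\beta$ and $F\in C^5(0,\infty)$ (real valued) with $F''>0$ on $(0,\overline\alpha)\cup(\underline\beta,\infty)$, $F''<0$ on $(\overline\alpha,\underline\beta)$, $F'(0)<F'(\underline\beta)$ and $F'(\infty)>F'(\overline\alpha)$, where $F'(0),F'(\infty)$ denote the limits of $F'$ at $0^+$ and $+\infty$. Put $\underline\sigma:=F'(\underline\beta)$, $\overline\sigma:=F'(\overline\alpha)$ and, for $\sigma\in[\underline\sigma,\overline\sigma]$, let $\Phi_\sigma(z):=F(z)-\sigma z$. Its critical points are $\alpha_\sigma\le\zeta_\sigma\le\beta_\sigma$, the solutions of $F'(\cdot)=\sigma$ in $(0,\overline\alpha]$, $[\overline\alpha,\underline\beta]$, $[\underline\beta,\infty)$ respectively. The value $\sigma_0\in(\underline\sigma,\overline\sigma)$ is the unique one for which $\Phi_{\sigma_0}(\alpha_{\sigma_0})=\Phi_{\sigma_0}(\beta_{\sigma_0})$; write $\alpha_0=\alpha_{\sigma_0}$, $\beta_0=\beta_{\sigma_0}$, $b_0=\Phi_{\sigma_0}(\alpha_0)=\Phi_{\sigma_0}(\beta_0)$, $\Delta_0=(\sigma_0,b_0)$ (Maxwell point). A pair $\Delta=(\sigma,b)$ is admissible if $\sigma\in(\underline\sigma,\overline\sigma)$ and $\max\{\Phi_\sigma(\alpha_\sigma),\Phi_\sigma(\beta_\sigma)\}<b<\Phi_\sigma(\zeta_\sigma)$. For admissible $\Delta$, $z_1(\Delta)\in(\alpha_\sigma,\zeta_\sigma)$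 and $z_2(\Delta)\in(\zeta_\sigma,\beta_\sigma)$ are the solutions of $\Phi_\sigma(z_i)=b$. Consider the problem: find a positive function $z$ and $\sigma\in\mathbb R$ with $Q''(\varepsilon z')z''=F'(z)-\sigma$ in $(-\varepsilon^{-1},\varepsilon^{-1})$, $z'(\pm\varepsilon^{-1})=0$, $\int_{-\varepsilon^{-1}}^{\varepsilon^{-1}}z\,dx=2r\varepsilon^{-1}$. A simple solution is a (non-constant) increasing solution; it satisfies $P_\varepsilon(z')=\Phi_\sigma(z)-b$ for a constant $b$, with $P_\varepsilon(s)=\varepsilon^{-2}\bigl(1-\tfrac{1}{\sqrt{1+\varepsilon^2s^2}}\bigr)$, and its corresponding admissible pair is $\Delta=(\sigma,b)$. Maxwell solution: for every $\delta\in(0,(\beta_0-\alpha_0)/2)$ there exist $\varepsilon_\delta>0$ and a neighborhood $\mathcal N_\delta$ of $\Delta_0$ such that for $\varepsilon\in(0,\varepsilon_\delta)$ and $r\in[\alpha_0+\delta,\beta_0-\delta]$ there is exactly one simple solution whose admissible pair $\Delta(\varepsilon,r)$ lies in $\mathcal N_\delta$, and, for some $C=C_\delta>0$, $\Delta(\varepsilon,r)=\Delta_0+O(\exp(-C/\varepsilon))$, $z_1(\Delta(\varepsilon,r))=\alpha_0+O(\exp(-C/\varepsilon))$, $z_2(\Delta(\varepsilon,r))=\beta_0+O(\exp(-C/\varepsilon))$ as $\varepsilon\to0^+$, uniformly in such $r$. This solution is the Maxwell solution $z_{\varepsilon r}$. *)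

theory Defs
  imports "HOL-Analysis.Analysis"
begin

definition C_k_on :: "nat \<Rightarrow> (real \<Rightarrow> real) \<Rightarrow> real set \<Rightarrow> bool" where
  "C_k_on k f S \<longleftrightarrow>
     (\<forall>j<k. \<forall>x\<in>S. (deriv ^^ j) f field_differentiable (at x)) \<and>
     continuous_on S ((deriv ^^ k) f)"

text \<open>Throughout, \<open>al\<close> and \<open>be\<close> are the two inflection points of \<open>F\<close> (alpha-bar and
  beta-underline). Functions of type \<^typ>\<open>real \<Rightarrow> real\<close> are only relevant on the positive
  half-line (for \<open>F\<close>), respectively on the interval of the boundary value problem. The
  limits of the derivative at 0 and at infinity may be infinite, hence the extended reals.\<close>

definition two_phase :: "(real \<Rightarrow> real) \<Rightarrow> real \<Rightarrow> real \<Rightarrow> bool" where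
  "two_phase F al be \<longleftrightarrow>
     0 < al \<and> al < be \<and> C_k_on 5 F {0<..} \<and>
     (\<forall>z\<in>{0<..<al} \<union> {be<..}. deriv (deriv F) z > 0) \<and>
     (\<forall>z\<in>{al<..<be}. deriv (deriv F) z < 0) \<and>
     (\<exists>L::ereal. ((\<lambda>z. ereal (deriv F z)) \<longlongrightarrow> L) (at_right 0) \<and> L < ereal (deriv F be)) \<and>
     (\<exists>L::ereal. ((\<lambda>z. ereal (deriv F z)) \<longlongrightarrow> L) at_top \<and> L > ereal (deriv F al))"

definition Phi :: "(real \<Rightarrow> real) \<Rightarrow> real \<Rightarrow> real \<Rightarrow> real" where
  "Phi F \<sigma> z = F z - \<sigma> * z"

definition sigma_lo :: "(real \<Rightarrow> real) \<Rightarrow> real \<Rightarrow> real" where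
  "sigma_lo F be = deriv F be"

definition sigma_hi :: "(real \<Rightarrow> real) \<Rightarrow> real \<Rightarrow> real" where
  "sigma_hi F al = deriv F al"

text \<open>The following three functions are meant for \<open>\<sigma>\<close> between \<^const>\<open>sigma_lo\<close> and
  \<^const>\<open>sigma_hi\<close> (inclusive), where the described points exist and are unique because
  the derivative of \<open>F\<close> is strictly monotone on each of the three intervals.\<close>

definition alpha_crit :: "(real \<Rightarrow> real) \<Rightarrow> real \<Rightarrow> real \<Rightarrow> real" where
  "alpha_crit F al \<sigma> = (THE z. z \<in> {0<..al} \<and> deriv F z = \<sigma>)"

definition zeta_crit :: "(real \<Rightarrow> real) \<Rightarrow> real \<Rightarrow> real \<Rightarrow> real \<Rightarrow> real" where
  "zeta_crit F al be \<sigma> = (THE z. z \<in> {al..be} \<and> deriv F z = \<sigma>)"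

definition beta_crit :: "(real \<Rightarrow> real) \<Rightarrow> real \<Rightarrow> real \<Rightarrow> real" where
  "beta_crit F be \<sigma> = (THE z. z \<in> {be..} \<and> deriv F z = \<sigma>)"

definition sigma0 :: "(real \<Rightarrow> real) \<Rightarrow> real \<Rightarrow> real \<Rightarrow> real" where
  "sigma0 F al be = (THE \<sigma>. \<sigma> \<in> {sigma_lo F be<..<sigma_hi F al} \<and>
     Phi F \<sigma> (alpha_crit F al \<sigma>) = Phi F \<sigma> (beta_crit F be \<sigma>))"

definition alpha0 :: "(real \<Rightarrow> real) \<Rightarrow> real \<Rightarrow> real \<Rightarrow> real" where
  "alpha0 F al be = alpha_crit F al (sigma0 F al be)"

definition beta0 :: "(real \<Rightarrow> real) \<Rightarrow> real \<Rightarrow> real \<Rightarrow> real" where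
  "beta0 F al be = beta_crit F be (sigma0 F al be)"

definition b0 :: "(real \<Rightarrow> real) \<Rightarrow> real \<Rightarrow> real \<Rightarrow> real" where
  "b0 F al be = Phi F (sigma0 F al be) (alpha0 F al be)"

definition Delta0 :: "(real \<Rightarrow> real) \<Rightarrow> real \<Rightarrow> real \<Rightarrow> real \<times> real" where
  "Delta0 F al be = (sigma0 F al be, b0 F al be)"

definition admissible :: "(real \<Rightarrow> real) \<Rightarrow> real \<Rightarrow> real \<Rightarrow> real \<times> real \<Rightarrow> bool" where
  "admissible F al be = (\<lambda>(\<sigma>, b).
     \<sigma> \<in> {sigma_lo F be<..<sigma_hi F al} \<and>
     max (Phi F \<sigma> (alpha_crit F al \<sigma>)) (Phi F \<sigma> (beta_crit F be \<sigma>)) < b \<and>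
     b < Phi F \<sigma> (zeta_crit F al be \<sigma>))"

definition z1 :: "(real \<Rightarrow> real) \<Rightarrow> real \<Rightarrow> real \<Rightarrow> real \<times> real \<Rightarrow> real" where
  "z1 F al be = (\<lambda>(\<sigma>, b).
     THE z. z \<in> {alpha_crit F al \<sigma><..<zeta_crit F al be \<sigma>} \<and> Phi F \<sigma> z = b)"

definition z2 :: "(real \<Rightarrow> real) \<Rightarrow> real \<Rightarrow> real \<Rightarrow> real \<times> real \<Rightarrow> real" where
  "z2 F al be = (\<lambda>(\<sigma>, b).
     THE z. z \<in> {zeta_crit F al be \<sigma><..<beta_crit F be \<sigma>} \<and> Phi F \<sigma> z = b)"

definition Q :: "real \<Rightarrow> real" where
  "Q s = sqrt (1 + s\<^sup>2) - 1"

definition P :: "real \<Rightarrow> real \<Rightarrow> real" where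
  "P \<epsilon> s = (1 - 1 / sqrt (1 + \<epsilon>\<^sup>2 * s\<^sup>2)) / \<epsilon>\<^sup>2"

text \<open>Classical solutions: continuously differentiable up to the boundary (\<open>z'\<close> is the
  derivative, one-sided at the two end points), twice differentiable inside (\<open>z''\<close>).\<close>

definition bvp_solution ::
    "(real \<Rightarrow> real) \<Rightarrow> real \<Rightarrow> real \<Rightarrow> real \<Rightarrow> (real \<Rightarrow> real) \<Rightarrow> (real \<Rightarrow> real) \<Rightarrow> bool" where
  "bvp_solution F \<epsilon> r \<sigma> z z' \<longleftrightarrow>
     (\<forall>x\<in>{-1/\<epsilon>..1/\<epsilon>}. z x > 0) \<and>
     (\<forall>x\<in>{-1/\<epsilon>..1/\<epsilon>}. (z has_real_derivative z' x) (at x within {-1/\<epsilon>..1/\<epsilon>})) \<and>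
     continuous_on {-1/\<epsilon>..1/\<epsilon>} z' \<and>
     (\<exists>z''. \<forall>x\<in>{-1/\<epsilon><..<1/\<epsilon>}. (z' has_real_derivative z'' x) (at x) \<and>
        deriv (deriv Q) (\<epsilon> * z' x) * z'' x = deriv F (z x) - \<sigma>) \<and>
     z' (-1/\<epsilon>) = 0 \<and> z' (1/\<epsilon>) = 0 \<and>
     (z has_integral (2 * r / \<epsilon>)) {-1/\<epsilon>..1/\<epsilon>}"

text \<open>\<open>z\<close> is a simple solution and \<open>(\<sigma>, b)\<close> is its admissible pair.\<close>

definition simple_solution ::
    "(real \<Rightarrow> real) \<Rightarrow> real \<Rightarrow> real \<Rightarrow> real \<Rightarrow> real \<Rightarrow> (real \<Rightarrow> real) \<Rightarrow> real \<times> real \<Rightarrow> bool" where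
  "simple_solution F al be \<epsilon> r z = (\<lambda>(\<sigma>, b).
     mono_on {-1/\<epsilon>..1/\<epsilon>} z \<and> \<not> z constant_on {-1/\<epsilon>..1/\<epsilon>} \<and>
     admissible F al be (\<sigma>, b) \<and>
     (\<exists>z'. bvp_solution F \<epsilon> r \<sigma> z z' \<and>
        (\<forall>x\<in>{-1/\<epsilon>..1/\<epsilon>}. P \<epsilon> (z' x) = Phi F \<sigma> (z x) - b)))"

text \<open>\<open>z \<epsilon> r\<close> is the Maxwell solution with parameters \<open>\<epsilon>\<close>, \<open>r\<close>, and \<open>D \<epsilon> r\<close> is its
  admissible pair. Uniqueness can only be meant on the interval of the problem, since the
  values of a HOL function outside of it are arbitrary. The values \<open>z \<epsilon> r\<close> are constrained
  only where the Maxwell solution is defined, i.e. for \<open>\<epsilon>\<close> small depending on \<open>\<delta>\<close>.\<close>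

definition maxwell_solution ::
    "(real \<Rightarrow> real) \<Rightarrow> real \<Rightarrow> real \<Rightarrow> (real \<Rightarrow> real \<Rightarrow> real \<Rightarrow> real)
      \<Rightarrow> (real \<Rightarrow> real \<Rightarrow> real \<times> real) \<Rightarrow> bool" where
  "maxwell_solution F al be z D \<longleftrightarrow>
     (\<forall>\<delta>\<in>{0<..<(beta0 F al be - alpha0 F al be) / 2}.
        (\<exists>\<epsilon>\<^sub>\<delta>>0. \<exists>N. open N \<and> Delta0 F al be \<in> N \<and>
          (\<forall>\<epsilon>\<in>{0<..<\<epsilon>\<^sub>\<delta>}. \<forall>r\<in>{alpha0 F al be + \<delta>..beta0 F al be - \<delta>}.
             simple_solution F al be \<epsilon> r (z \<epsilon> r) (D \<epsilon> r) \<and> D \<epsilon> r \<in> N \<and>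
             (\<forall>w \<Delta>. simple_solution F al be \<epsilon> r w \<Delta> \<and> \<Delta> \<in> N \<longrightarrow>
                (\<forall>x\<in>{-1/\<epsilon>..1/\<epsilon>}. w x = z \<epsilon> r x)))) \<and>
        (\<exists>C>0. \<exists>K. \<forall>\<^sub>F \<epsilon> in at_right 0. \<forall>r\<in>{alpha0 F al be + \<delta>..beta0 F al be - \<delta>}.
           norm (D \<epsilon> r - Delta0 F al be) \<le> K * exp (- C / \<epsilon>) \<and>
           \<bar>z1 F al be (D \<epsilon> r) - alpha0 F al be\<bar> \<le> K * exp (- C / \<epsilon>) \<and>
           \<bar>z2 F al be (D \<epsilon> r) - beta0 F al be\<bar> \<le> K * exp (- C / \<epsilon>)))"

definition ell1 :: "(real \<Rightarrow> real) \<Rightarrow> real \<Rightarrow> real \<Rightarrow> real \<Rightarrow> real" where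
  "ell1 F al be r = 2 * (beta0 F al be - r) / (beta0 F al be - alpha0 F al be)"

definition ell2 :: "(real \<Rightarrow> real) \<Rightarrow> real \<Rightarrow> real \<Rightarrow> real \<Rightarrow> real" where
  "ell2 F al be r = 2 * (r - alpha0 F al be) / (beta0 F al be - alpha0 F al be)"

definition u0 :: "(real \<Rightarrow> real) \<Rightarrow> real \<Rightarrow> real \<Rightarrow> real \<Rightarrow> real \<Rightarrow> real" where
  "u0 F al be r x = (if x \<le> -1 + ell1 F al be r then alpha0 F al be else beta0 F al be)"

definition rescaled :: "(real \<Rightarrow> real \<Rightarrow> real \<Rightarrow> real) \<Rightarrow> real \<Rightarrow> real \<Rightarrow> real \<Rightarrow> real" where
  "rescaled z \<epsilon> r x = z \<epsilon> r (x / \<epsilon>)"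

definition rescaled_reversed :: "(real \<Rightarrow> real \<Rightarrow> real \<Rightarrow> real) \<Rightarrow> real \<Rightarrow> real \<Rightarrow> real \<Rightarrow> real" where
  "rescaled_reversed z \<epsilon> r x = rescaled z \<epsilon> r (-x)"

end

theory Submission
  imports Defs "HOL-Real_Asymp.Real_Asymp"
begin

text \<open>The increasing profile runs from \<open>z\<^sub>1\<close> to \<open>z\<^sub>2\<close>, which tend to \<open>\<alpha>\<^sub>0\<close> and \<open>\<beta>\<^sub>0\<close>. On
  \<open>[\<alpha>\<^sub>0 + \<eta>, \<beta>\<^sub>0 - \<eta>]\<close> the function \<open>\<Phi>\<^sub>\<sigma> - b\<close> stays above some \<open>c > 0\<close> for small \<open>\<epsilon>\<close>, and
  \<open>P\<^sub>\<epsilon>(s) \<le> s\<^sup>2/2\<close> turns this into \<open>z' \<ge> sqrt (2c)\<close>. Hence the transition layer has length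
  \<open>O(1)\<close>, that is \<open>O(\<epsilon>)\<close> after rescaling, and the prescribed integral forces its position.\<close>

section \<open>The two-phase energy\<close>

lemma two_phase_deriv:
  assumes "two_phase F al be" "z > 0"
  shows "(F has_real_derivative deriv F z) (at z)"
    and "(deriv F has_real_derivative deriv (deriv F) z) (at z)"
proof -
  have *: "(deriv ^^ j) F field_differentiable at z" if "j < 5" for j
    using assms that unfolding two_phase_def C_k_on_def by auto
  show "(F has_real_derivative deriv F z) (at z)"
    using *[of 0] by (simp add: DERIV_deriv_iff_field_differentiable)
  show "(deriv F has_real_derivative deriv (deriv F) z) (at z)"
    using *[of 1] by (simp add: DERIV_deriv_iff_field_differentiable)
qed

lemma two_phase_isCont:
  assumes "two_phase F al be" "z > 0"
  shows "isCont F z" "isCont (deriv F) z"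
  using two_phase_deriv[OF assms] by (auto intro: DERIV_isCont)

text \<open>The sign of the second derivative is given only on open intervals; continuity of
  \<open>deriv F\<close> at \<open>al\<close> and \<open>be\<close> extends strictness to the
  inflection points themselves.\<close>

lemma two_phase_strict_mono:
  assumes "two_phase F al be"
  shows "strict_mono_on {0<..al} (deriv F)"
    and "strict_antimono_on {al..be} (deriv F)"
    and "strict_mono_on {be..} (deriv F)"
proof -
  have pos: "0 < al" "al < be" using assms by (auto simp: two_phase_def)
  have d: "(deriv F has_real_derivative deriv (deriv F) z) (at z)" "isCont (deriv F) z" if "z > 0" for z
    using two_phase_deriv two_phase_isCont assms that by blast+
  have s1: "deriv (deriv F) z > 0" if "0 < z \<and> z < al \<or> be < z" for z
    using assms that by (auto simp: two_phase_def)
  have s2: "deriv (deriv F) z < 0" if "al < z" "z < be" for z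
    using assms that by (auto simp: two_phase_def)
  show "strict_mono_on {0<..al} (deriv F)"
  proof (rule strict_mono_onI)
    fix x y assume xy: "x \<in> {0<..al}" "y \<in> {0<..al}" "x < y"
    show "deriv F x < deriv F y"
    proof (rule DERIV_pos_imp_increasing_open[OF \<open>x < y\<close>])
      show "\<exists>m. DERIV (deriv F) t :> m \<and> m > 0" if "x < t" "t < y" for t
        using d(1)[of t] s1[of t] xy that by (intro exI[of _ "deriv (deriv F) t"]) auto
      show "continuous_on {x..y} (deriv F)"
        using xy d(2) by (intro continuous_at_imp_continuous_on) auto
    qed
  qed
  show "strict_mono_on {be..} (deriv F)"
  proof (rule strict_mono_onI)
    fix x y assume xy: "x \<in> {be..}" "y \<in> {be..}" "x < y"
    show "deriv F x < deriv F y"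
    proof (rule DERIV_pos_imp_increasing_open[OF \<open>x < y\<close>])
      show "\<exists>m. DERIV (deriv F) t :> m \<and> m > 0" if "x < t" "t < y" for t
        using d(1)[of t] s1[of t] xy that pos by (intro exI[of _ "deriv (deriv F) t"]) auto
      show "continuous_on {x..y} (deriv F)"
        using xy d(2) pos by (intro continuous_at_imp_continuous_on) auto
    qed
  qed
  show "strict_antimono_on {al..be} (deriv F)"
  proof (rule monotone_onI)
    fix x y assume xy: "x \<in> {al..be}" "y \<in> {al..be}" "x < y"
    show "deriv F x > deriv F y"
    proof (rule DERIV_neg_imp_decreasing_open[OF \<open>x < y\<close>])
      show "\<exists>m. DERIV (deriv F) t :> m \<and> m < 0" if "x < t" "t < y" for t
        using d(1)[of t] s2[of t] xy that pos by (intro exI[of _ "deriv (deriv F) t"]) auto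
      show "continuous_on {x..y} (deriv F)"
        using xy d(2) pos by (intro continuous_at_imp_continuous_on) auto
    qed
  qed
qed

section \<open>Critical points of the tilted energy\<close>

text \<open>Makes the definite description proper: the limit of \<open>deriv F\<close> at 0 lies
  below \<open>deriv F be\<close>, hence below \<sigma>, and the intermediate value theorem applies
  up to \<open>al\<close>. The range of \<sigma> is closed because \<open>sigma0\<close> is later
  located only as a limit of admissible values.\<close>

lemma alpha_crit:
  assumes tp: "two_phase F al be" and \<sigma>: "\<sigma> \<in> {sigma_lo F be..sigma_hi F al}"
  shows "alpha_crit F al \<sigma> \<in> {0<..al}" "deriv F (alpha_crit F al \<sigma>) = \<sigma>"
proof -
  have pos: "0 < al" "al < be" using tp by (auto simp: two_phase_def)
  have "\<exists>!z. z \<in> {0<..al} \<and> deriv F z = \<sigma>"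
  proof (rule ex_ex1I)
    obtain L where L: "((\<lambda>z. ereal (deriv F z)) \<longlongrightarrow> L) (at_right 0)" "L < ereal (deriv F be)"
      using tp by (auto simp: two_phase_def)
    have "eventually (\<lambda>z. deriv F z < \<sigma> \<and> z \<in> {0<..<al}) (at_right 0)"
    proof (rule eventually_conj)
      have "ereal (deriv F be) \<le> ereal \<sigma>" using \<sigma> by (simp add: sigma_lo_def)
      with L(2) have "L < ereal \<sigma>" by (rule less_le_trans)
      from order_tendstoD(2)[OF L(1) this]
      show "eventually (\<lambda>z. deriv F z < \<sigma>) (at_right 0)" by simp
      show "eventually (\<lambda>z. z \<in> {0<..<al}) (at_right 0)"
        using pos by (intro eventually_at_right_real)
    qed
    then obtain w where w: "deriv F w < \<sigma>" "w \<in> {0<..<al}"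
      using eventually_happens' trivial_limit_at_right_real by blast
    have "\<exists>z\<ge>w. z \<le> al \<and> deriv F z = \<sigma>"
      using w \<sigma> two_phase_isCont(2)[OF tp]
      by (intro IVT) (auto simp: sigma_hi_def)
    then obtain z where "w \<le> z" "z \<le> al" "deriv F z = \<sigma>" by blast
    then show "\<exists>z. z \<in> {0<..al} \<and> deriv F z = \<sigma>" using w by (intro exI[of _ z]) auto
    show "y = z" if "y \<in> {0<..al} \<and> deriv F y = \<sigma>" "z \<in> {0<..al} \<and> deriv F z = \<sigma>" for y z
      using strict_mono_on_eqD[OF two_phase_strict_mono(1)[OF tp]] that by metis
  qed
  from theI'[OF this]
  show "alpha_crit F al \<sigma> \<in> {0<..al}" "deriv F (alpha_crit F al \<sigma>) = \<sigma>"
    unfolding alpha_crit_def by blast+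
qed

text \<open>Here \<open>sigma_hi\<close> and \<open>sigma_lo\<close> are the values of
  \<open>deriv F\<close> at the two ends of the interval, so they bracket \<sigma>.\<close>

lemma zeta_crit:
  assumes tp: "two_phase F al be" and \<sigma>: "\<sigma> \<in> {sigma_lo F be..sigma_hi F al}"
  shows "zeta_crit F al be \<sigma> \<in> {al..be}" "deriv F (zeta_crit F al be \<sigma>) = \<sigma>"
proof -
  have pos: "0 < al" "al < be" using tp by (auto simp: two_phase_def)
  have "\<exists>!z. z \<in> {al..be} \<and> deriv F z = \<sigma>"
  proof (rule ex_ex1I)
    have "\<exists>z\<ge>al. z \<le> be \<and> deriv F z = \<sigma>"
      using pos \<sigma> two_phase_isCont(2)[OF tp]
      by (intro IVT2) (auto simp: sigma_hi_def sigma_lo_def)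
    then show "\<exists>z. z \<in> {al..be} \<and> deriv F z = \<sigma>" by force
    show "y = z" if "y \<in> {al..be} \<and> deriv F y = \<sigma>" "z \<in> {al..be} \<and> deriv F z = \<sigma>" for y z
      using monotone_onD[OF two_phase_strict_mono(2)[OF tp], of y z]
        monotone_onD[OF two_phase_strict_mono(2)[OF tp], of z y] that
      by (metis less_irrefl linorder_less_linear)
  qed
  from theI'[OF this]
  show "zeta_crit F al be \<sigma> \<in> {al..be}" "deriv F (zeta_crit F al be \<sigma>) = \<sigma>"
    unfolding zeta_crit_def by blast+
qed

text \<open>Mirror image of \<open>alpha_crit\<close>: the limit at infinity supplies a point where
  \<open>deriv F\<close> exceeds \<sigma>.\<close>

lemma beta_crit:
  assumes tp: "two_phase F al be" and \<sigma>: "\<sigma> \<in> {sigma_lo F be..sigma_hi F al}"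
  shows "beta_crit F be \<sigma> \<in> {be..}" "deriv F (beta_crit F be \<sigma>) = \<sigma>"
proof -
  have pos: "0 < al" "al < be" using tp by (auto simp: two_phase_def)
  have "\<exists>!z. z \<in> {be..} \<and> deriv F z = \<sigma>"
  proof (rule ex_ex1I)
    obtain L where L: "((\<lambda>z. ereal (deriv F z)) \<longlongrightarrow> L) at_top" "L > ereal (deriv F al)"
      using tp by (auto simp: two_phase_def)
    have "eventually (\<lambda>z. deriv F z > \<sigma> \<and> z > be) at_top"
    proof (rule eventually_conj)
      have "ereal \<sigma> \<le> ereal (deriv F al)" using \<sigma> by (simp add: sigma_hi_def)
      then have "L > ereal \<sigma>" using L(2) by (rule le_less_trans)
      from order_tendstoD(1)[OF L(1) this]
      show "eventually (\<lambda>z. deriv F z > \<sigma>) at_top" by simp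
      show "eventually (\<lambda>z. z > be) at_top" by (rule eventually_gt_at_top)
    qed
    then obtain w where w: "deriv F w > \<sigma>" "w > be"
      using eventually_happens' trivial_limit_at_top_linorder by blast
    have "\<exists>z\<ge>be. z \<le> w \<and> deriv F z = \<sigma>"
      using w \<sigma> pos two_phase_isCont(2)[OF tp]
      by (intro IVT) (auto simp: sigma_lo_def)
    then show "\<exists>z. z \<in> {be..} \<and> deriv F z = \<sigma>" by force
    show "y = z" if "y \<in> {be..} \<and> deriv F y = \<sigma>" "z \<in> {be..} \<and> deriv F z = \<sigma>" for y z
      using strict_mono_on_eqD[OF two_phase_strict_mono(3)[OF tp]] that by metis
  qed
  from theI'[OF this]
  show "beta_crit F be \<sigma> \<in> {be..}" "deriv F (beta_crit F be \<sigma>) = \<sigma>"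
    unfolding beta_crit_def by blast+
qed

section \<open>Shape of the tilted energy\<close>

lemma Phi_deriv:
  assumes "two_phase F al be" "z > 0"
  shows "(Phi F \<sigma> has_real_derivative deriv F z - \<sigma>) (at z)"
proof -
  have "((\<lambda>z. F z - \<sigma> * z) has_real_derivative deriv F z - \<sigma>) (at z)"
    by (rule derivative_eq_intros two_phase_deriv(1)[OF assms] refl | simp)+
  then show ?thesis by (simp add: Phi_def[abs_def])
qed

lemma Phi_increasing:
  assumes tp: "two_phase F al be" and "0 < x" "x < y"
    and "\<And>t. x < t \<Longrightarrow> t < y \<Longrightarrow> deriv F t > \<sigma>"
  shows "Phi F \<sigma> x < Phi F \<sigma> y"
proof (rule DERIV_pos_imp_increasing_open[OF \<open>x < y\<close>])
  show "\<exists>m. DERIV (Phi F \<sigma>) t :> m \<and> m > 0" if "x < t" "t < y" for t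
    using Phi_deriv[OF tp, of t] assms that by (intro exI[of _ "deriv F t - \<sigma>"]) auto
  show "continuous_on {x..y} (Phi F \<sigma>)"
    using assms(2)
    by (intro continuous_at_imp_continuous_on) (auto intro!: DERIV_isCont[OF Phi_deriv[OF tp]])
qed

lemma Phi_decreasing:
  assumes tp: "two_phase F al be" and "0 < x" "x < y"
    and "\<And>t. x < t \<Longrightarrow> t < y \<Longrightarrow> deriv F t < \<sigma>"
  shows "Phi F \<sigma> y < Phi F \<sigma> x"
proof (rule DERIV_neg_imp_decreasing_open[OF \<open>x < y\<close>])
  show "\<exists>m. DERIV (Phi F \<sigma>) t :> m \<and> m < 0" if "x < t" "t < y" for t
    using Phi_deriv[OF tp, of t] assms that by (intro exI[of _ "deriv F t - \<sigma>"]) auto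
  show "continuous_on {x..y} (Phi F \<sigma>)"
    using assms(2)
    by (intro continuous_at_imp_continuous_on) (auto intro!: DERIV_isCont[OF Phi_deriv[OF tp]])
qed

text \<open>On the four intervals cut out by the critical points, \<open>deriv F - \<sigma>\<close>
  has the signs -, +, -, +, each obtained by comparison with a critical point on the same monotone
  branch of \<open>deriv F\<close>.\<close>

lemma Phi_strict_mono:
  assumes tp: "two_phase F al be" and \<sigma>: "\<sigma> \<in> {sigma_lo F be..sigma_hi F al}"
  defines "\<alpha> \<equiv> alpha_crit F al \<sigma>" and "\<zeta> \<equiv> zeta_crit F al be \<sigma>" and "\<beta> \<equiv> beta_crit F be \<sigma>"
  shows "strict_antimono_on {0<..\<alpha>} (Phi F \<sigma>)"
    and "strict_mono_on {\<alpha>..\<zeta>} (Phi F \<sigma>)"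
    and "strict_antimono_on {\<zeta>..\<beta>} (Phi F \<sigma>)"
    and "strict_mono_on {\<beta>..} (Phi F \<sigma>)"
proof -
  have a: "\<alpha> > 0" "\<alpha> \<le> al" "deriv F \<alpha> = \<sigma>" using alpha_crit[OF tp \<sigma>] by (auto simp: \<alpha>_def)
  have z: "\<zeta> \<ge> al" "\<zeta> \<le> be" "deriv F \<zeta> = \<sigma>" using zeta_crit[OF tp \<sigma>] by (auto simp: \<zeta>_def)
  have b: "\<beta> \<ge> be" "deriv F \<beta> = \<sigma>" using beta_crit[OF tp \<sigma>] by (auto simp: \<beta>_def)
  have m1: "deriv F s < deriv F t" if "0 < s" "s < t" "t \<le> al" for s t
    using strict_mono_onD[OF two_phase_strict_mono(1)[OF tp], of s t] that by auto
  have m2: "deriv F s > deriv F t" if "al \<le> s" "s < t" "t \<le> be" for s t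
    using monotone_onD[OF two_phase_strict_mono(2)[OF tp], of s t] that by auto
  have m3: "deriv F s < deriv F t" if "be \<le> s" "s < t" for s t
    using strict_mono_onD[OF two_phase_strict_mono(3)[OF tp], of s t] that by auto
  have d1: "deriv F t < \<sigma>" if "0 < t" "t < \<alpha>" for t using m1[of t \<alpha>] a that by auto
  \<comment> \<open>The inflection point \<open>al\<close> lies between these critical points: left
    of it \<open>t\<close> is compared with \<alpha>, right of it with \<zeta>.\<close>
  have d2: "deriv F t > \<sigma>" if "\<alpha> < t" "t < \<zeta>" for t
    using m1[of \<alpha> t] m2[of t \<zeta>] a z that by (cases "t \<le> al") auto
  have d3: "deriv F t < \<sigma>" if "\<zeta> < t" "t < \<beta>" for t
    using m2[of \<zeta> t] m3[of t \<beta>] b z that by (cases "t \<le> be") auto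
  have d4: "deriv F t > \<sigma>" if "\<beta> < t" for t using m3[of \<beta> t] b that by auto
  have pos: "0 < \<zeta>" "0 < \<beta>" using a z b by auto
  show "strict_antimono_on {0<..\<alpha>} (Phi F \<sigma>)"
    by (rule monotone_onI) (auto intro!: Phi_decreasing[OF tp] d1)
  show "strict_mono_on {\<alpha>..\<zeta>} (Phi F \<sigma>)"
    using a(1) by (intro strict_mono_onI) (auto intro!: Phi_increasing[OF tp] d2)
  show "strict_antimono_on {\<zeta>..\<beta>} (Phi F \<sigma>)"
    using pos by (intro monotone_onI) (auto intro!: Phi_decreasing[OF tp] d3)
  show "strict_mono_on {\<beta>..} (Phi F \<sigma>)"
    using pos by (intro strict_mono_onI) (auto intro!: Phi_increasing[OF tp] d4)
qed

text \<open>With both wells at height \<open>b\<close>, the energy climbs from the left well to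
  \<zeta> and descends to the right one; a point on either slope is compared with the well at its
  foot.\<close>

lemma Phi_gt_between_wells:
  assumes tp: "two_phase F al be" and \<sigma>: "\<sigma> \<in> {sigma_lo F be..sigma_hi F al}"
    and "Phi F \<sigma> (alpha_crit F al \<sigma>) = b" "Phi F \<sigma> (beta_crit F be \<sigma>) = b"
    and t: "alpha_crit F al \<sigma> < t" "t < beta_crit F be \<sigma>"
  shows "b < Phi F \<sigma> t"
proof (cases "t \<le> zeta_crit F al be \<sigma>")
  case True
  then show ?thesis
    using strict_mono_onD[OF Phi_strict_mono(2)[OF tp \<sigma>], of "alpha_crit F al \<sigma>" t] assms by auto
next
  case False
  then show ?thesis
    using monotone_onD[OF Phi_strict_mono(3)[OF tp \<sigma>], of t "beta_crit F be \<sigma>"] assms by auto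
qed

section \<open>Simple solutions\<close>

text \<open>Strict monotonicity on the rising branch makes the point at level \<open>b\<close>
  unique, so an endpoint value of a profile can be identified with \<open>z1\<close>.\<close>

lemma z1_eqI:
  assumes tp: "two_phase F al be" and \<sigma>: "\<sigma> \<in> {sigma_lo F be..sigma_hi F al}"
    and "alpha_crit F al \<sigma> < t" "t < zeta_crit F al be \<sigma>" "Phi F \<sigma> t = b"
  shows "z1 F al be (\<sigma>, b) = t"
  unfolding z1_def prod.case
proof (rule the_equality)
  fix s assume s: "s \<in> {alpha_crit F al \<sigma><..<zeta_crit F al be \<sigma>} \<and> Phi F \<sigma> s = b"
  then show "s = t"
    using assms strict_mono_onD[OF Phi_strict_mono(2)[OF tp \<sigma>], of s t]
      strict_mono_onD[OF Phi_strict_mono(2)[OF tp \<sigma>], of t s] by force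
qed (use assms in auto)

lemma z2_eqI:
  assumes tp: "two_phase F al be" and \<sigma>: "\<sigma> \<in> {sigma_lo F be..sigma_hi F al}"
    and "zeta_crit F al be \<sigma> < t" "t < beta_crit F be \<sigma>" "Phi F \<sigma> t = b"
  shows "z2 F al be (\<sigma>, b) = t"
  unfolding z2_def prod.case
proof (rule the_equality)
  fix s assume s: "s \<in> {zeta_crit F al be \<sigma><..<beta_crit F be \<sigma>} \<and> Phi F \<sigma> s = b"
  then show "s = t"
    using assms monotone_onD[OF Phi_strict_mono(3)[OF tp \<sigma>], of s t]
      monotone_onD[OF Phi_strict_mono(3)[OF tp \<sigma>], of t s] by force
qed (use assms in auto)

lemma P_nonneg: "0 \<le> P \<epsilon> s"
proof -
  have "1 / sqrt (1 + \<epsilon>\<^sup>2 * s\<^sup>2) \<le> 1" by (subst divide_le_eq_1_pos) (auto intro: add_pos_nonneg)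
  then show ?thesis by (simp add: P_def)
qed

text \<open>A quadratic bound uniform in \<epsilon>, through which lower bounds on \<open>P\<close>
  become lower bounds on the slope. With \<open>q\<close> the square root it reads
  \<open>1 - 1/q \<le> (q\<^sup>2 - 1)/2\<close>.\<close>

lemma P_le:
  assumes "\<epsilon> > 0"
  shows "P \<epsilon> s \<le> s\<^sup>2 / 2"
proof -
  define q where "q = sqrt (1 + \<epsilon>\<^sup>2 * s\<^sup>2)"
  have q: "q \<ge> 1" "q\<^sup>2 = 1 + \<epsilon>\<^sup>2 * s\<^sup>2" by (auto simp: q_def)
  have "1 - 1 / q \<le> (q\<^sup>2 - 1) / 2"
  proof -
    have "2 * (q - 1) \<le> (q\<^sup>2 - 1) * q"
    proof -
      \<comment> \<open>Clearing the denominator leaves this product; both factors are nonnegative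
        since \<open>q\<close> is at least 1.\<close>
      have "(q - 1) * ((q + 1) * q - 2) \<ge> 0"
      proof (rule mult_nonneg_nonneg)
        have "2 * 1 \<le> (q + 1) * q" using q by (intro mult_mono) auto
        then show "0 \<le> (q + 1) * q - 2" by simp
      qed (use q in simp)
      then show ?thesis by (simp add: algebra_simps power2_eq_square)
    qed
    then show ?thesis using q(1) by (simp add: field_simps)
  qed
  then have "(1 - 1 / q) / \<epsilon>\<^sup>2 \<le> (\<epsilon>\<^sup>2 * s\<^sup>2 / 2) / \<epsilon>\<^sup>2"
    by (intro divide_right_mono) (simp_all add: q(2))
  then show ?thesis using assms by (simp add: P_def q_def)
qed

section \<open>End values and steepness of simple solutions\<close>

text \<open>At the ends \<open>z'\<close> vanishes, so both end values lie at level
  \<open>b\<close>. They are distinct, and no monotone branch of the energy can contain both; the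
  wells lie below \<open>b\<close> and are never crossed. This leaves one value on each side of
  \<zeta>, between the wells.\<close>

lemma simple_solution_endpoints:
  assumes tp: "two_phase F al be" and ss: "simple_solution F al be \<epsilon> r z \<Delta>" and "\<epsilon> > 0"
  shows "z (-1/\<epsilon>) = z1 F al be \<Delta>" "z (1/\<epsilon>) = z2 F al be \<Delta>"
proof -
  obtain \<sigma> b where \<Delta>: "\<Delta> = (\<sigma>, b)" by (cases \<Delta>)
  let ?I = "{-1/\<epsilon>..1/\<epsilon>}"
  define l u where "l = -1/\<epsilon>" and "u = 1/\<epsilon>"
  obtain z' where mono: "mono_on ?I z" and nconst: "\<not> z constant_on ?I"
    and adm: "admissible F al be (\<sigma>, b)" and bvp: "bvp_solution F \<epsilon> r \<sigma> z z'"
    and en: "\<And>x. x \<in> ?I \<Longrightarrow> P \<epsilon> (z' x) = Phi F \<sigma> (z x) - b"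
    using ss unfolding simple_solution_def \<Delta> by auto
  define \<alpha> \<zeta> \<beta> where "\<alpha> = alpha_crit F al \<sigma>" and "\<zeta> = zeta_crit F al be \<sigma>"
    and "\<beta> = beta_crit F be \<sigma>"
  have \<sigma>: "\<sigma> \<in> {sigma_lo F be..sigma_hi F al}"
    and b: "Phi F \<sigma> \<alpha> < b" "Phi F \<sigma> \<beta> < b" "b < Phi F \<sigma> \<zeta>"
    using adm by (auto simp: admissible_def \<alpha>_def \<beta>_def \<zeta>_def)
  note mono_Phi = Phi_strict_mono[OF tp \<sigma>, folded \<alpha>_def \<beta>_def \<zeta>_def]
  have lu: "l < u" using \<open>\<epsilon> > 0\<close> by (simp add: l_def u_def field_simps)
  have I: "?I = {l..u}" by (simp add: l_def u_def)
  have "z' l = 0" "z' u = 0" and zpos: "\<And>x. x \<in> {l..u} \<Longrightarrow> z x > 0"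
    using bvp by (auto simp: bvp_solution_def l_def u_def)
  then have eq: "Phi F \<sigma> (z l) = b" "Phi F \<sigma> (z u) = b"
    using en[of l] en[of u] lu unfolding I by (auto simp: P_def)
  have cont: "continuous_on {l..u} z"
    using bvp unfolding bvp_solution_def I by (intro DERIV_continuous_on) auto
  \<comment> \<open>Every intermediate value is attained, and there the energy identity with
    \<open>P \<ge> 0\<close> applies. In particular neither well belongs to the range of
    \<open>z\<close>.\<close>
  have above: "Phi F \<sigma> v \<ge> b" if v: "z l \<le> v" "v \<le> z u" for v
  proof -
    obtain x where "l \<le> x" "x \<le> u" "z x = v" using IVT'[OF v(1) v(2) _ cont] lu by auto
    then show ?thesis using en[of x] P_nonneg[of \<epsilon> "z' x"] unfolding I by auto
  qed
  have less: "z l < z u"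
  proof (rule ccontr)
    assume "\<not> z l < z u"
    moreover have "z l \<le> z x" "z x \<le> z u" if "x \<in> {l..u}" for x
      using that lu by (auto intro!: mono_onD[OF mono[unfolded I]])
    ultimately have "z x = z l" if "x \<in> {l..u}" for x
      using that by force
    then show False using nconst unfolding I constant_on_def by blast
  qed
  have pos: "z l > 0" "z u > 0" using zpos lu by auto
  have ord: "\<alpha> \<le> \<zeta>" "\<zeta> \<le> \<beta>"
    using alpha_crit[OF tp \<sigma>] zeta_crit[OF tp \<sigma>] beta_crit[OF tp \<sigma>]
    by (auto simp: \<alpha>_def \<beta>_def \<zeta>_def)
  \<comment> \<open>Otherwise the range, which omits \<alpha>, lies entirely to its left, on a
    strictly decreasing branch that meets level \<open>b\<close> at most once.\<close>
  have "\<alpha> < z l"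
  proof (rule ccontr)
    assume "\<not> \<alpha> < z l"
    then have "z u \<le> \<alpha>" using above[of \<alpha>] b by force
    then show False using monotone_onD[OF mono_Phi(1), of "z l" "z u"] less pos eq by auto
  qed
  moreover have "z u < \<beta>"
  proof (rule ccontr)
    assume "\<not> z u < \<beta>"
    then have "\<beta> \<le> z l" using above[of \<beta>] b by force
    then show False using strict_mono_onD[OF mono_Phi(4), of "z l" "z u"] less eq by auto
  qed
  moreover have "z l < \<zeta>"
  proof (rule ccontr)
    assume "\<not> z l < \<zeta>"
    then show False
      using monotone_onD[OF mono_Phi(3), of "z l" "z u"] less \<open>z u < \<beta>\<close> eq by auto
  qed
  moreover have "\<zeta> < z u"
  proof (rule ccontr)
    assume "\<not> \<zeta> < z u"
    then show False
      using strict_mono_onD[OF mono_Phi(2), of "z l" "z u"] less \<open>\<alpha> < z l\<close> eq by auto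
  qed
  ultimately show "z (-1/\<epsilon>) = z1 F al be \<Delta>" "z (1/\<epsilon>) = z2 F al be \<Delta>"
    using z1_eqI[OF tp \<sigma>, of "z l" b] z2_eqI[OF tp \<sigma>, of "z u" b] eq
    by (auto simp: \<Delta> \<alpha>_def \<beta>_def \<zeta>_def l_def u_def)
qed

text \<open>The energy identity at the ends, where \<open>P\<close> is zero. These levels are passed
  to the limit to compare the two wells.\<close>

lemma z_levels:
  assumes tp: "two_phase F al be" and ss: "simple_solution F al be \<epsilon> r z (\<sigma>, b)" and "\<epsilon> > 0"
  shows "Phi F \<sigma> (z1 F al be (\<sigma>, b)) = b" "Phi F \<sigma> (z2 F al be (\<sigma>, b)) = b"
proof -
  obtain z' where bvp: "bvp_solution F \<epsilon> r \<sigma> z z'"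
    and en: "\<And>x. x \<in> {-1/\<epsilon>..1/\<epsilon>} \<Longrightarrow> P \<epsilon> (z' x) = Phi F \<sigma> (z x) - b"
    using ss unfolding simple_solution_def by auto
  have "-1/\<epsilon> \<le> 1/\<epsilon>" using \<open>\<epsilon> > 0\<close> by (simp add: field_simps)
  then show "Phi F \<sigma> (z1 F al be (\<sigma>, b)) = b" "Phi F \<sigma> (z2 F al be (\<sigma>, b)) = b"
    using en[of "-1/\<epsilon>"] en[of "1/\<epsilon>"] bvp simple_solution_endpoints[OF tp ss \<open>\<epsilon> > 0\<close>]
    by (auto simp: bvp_solution_def P_def)
qed

text \<open>By the mean value theorem the increment is \<open>z' x * (t - s)\<close> for an
  intermediate \<open>x\<close>; there \<open>z x\<close> lies between \<open>z s\<close> and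
  \<open>z t\<close>, so \<open>c \<le> P \<epsilon> (z' x)\<close>, and \<open>P_le\<close> bounds
  the slope.\<close>

lemma simple_solution_growth:
  assumes ss: "simple_solution F al be \<epsilon> r z (\<sigma>, b)" and "\<epsilon> > 0" and "c \<ge> 0"
    and st: "-1/\<epsilon> \<le> s" "s \<le> t" "t \<le> 1/\<epsilon>"
    and c: "\<And>v. z s \<le> v \<Longrightarrow> v \<le> z t \<Longrightarrow> c \<le> Phi F \<sigma> v - b"
  shows "sqrt (2 * c) * (t - s) \<le> z t - z s"
proof (cases "s = t")
  case False
  then have "s < t" using st by simp
  let ?I = "{-1/\<epsilon>..1/\<epsilon>}"
  obtain z' where mono: "mono_on ?I z" and bvp: "bvp_solution F \<epsilon> r \<sigma> z z'"
    and en: "\<And>x. x \<in> ?I \<Longrightarrow> P \<epsilon> (z' x) = Phi F \<sigma> (z x) - b"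
    using ss unfolding simple_solution_def by auto
  have D: "(z has_real_derivative z' x) (at x within ?I)" if "x \<in> ?I" for x
    using bvp that by (auto simp: bvp_solution_def)
  have D': "(z has_real_derivative z' x) (at x)" if "s < x" "x < t" for x
  proof -
    have "x \<in> interior ?I" using that st by auto
    then show ?thesis using D[of x] interior_subset[of ?I] by (metis at_within_interior subsetD)
  qed
  have "continuous_on {s..t} z"
  proof (rule continuous_on_subset)
    show "continuous_on ?I z" using D by (rule DERIV_continuous_on)
  qed (use st in auto)
  from MVT[OF \<open>s < t\<close> this] D'
  obtain l x where x: "s < x" "x < t" "(z has_real_derivative l) (at x)" "z t - z s = (t - s) * l"
    by (metis real_differentiable_def)
  have l: "l = z' x" using DERIV_unique[OF x(3) D'] x by auto
  have xI: "x \<in> ?I" "x \<in> interior ?I" using x st by auto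
  \<comment> \<open>Monotonicity selects the nonnegative root of the slope estimate.\<close>
  have "z' x \<ge> 0" using mono_on_imp_deriv_nonneg[OF mono D'] x xI by auto
  have "c \<le> P \<epsilon> (z' x)"
    unfolding en[OF xI(1)]
    using x st by (intro c) (auto intro!: mono_onD[OF mono])
  then have "2 * c \<le> (z' x)\<^sup>2" using P_le[OF \<open>\<epsilon> > 0\<close>, of "z' x"] by linarith
  then have "sqrt (2 * c) \<le> z' x" using \<open>z' x \<ge> 0\<close> by (rule real_le_lsqrt[rotated])
  then show ?thesis using x l by (simp add: mult.commute mult_right_mono)
qed simp

section \<open>Location of the layer\<close>

text \<open>Turns pointwise bounds on the two sides of the layer into an inequality for the
  prescribed integral.\<close>

lemma has_integral_step_lower:
  fixes g :: "real \<Rightarrow> real"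
  assumes g: "(g has_integral I) {l..u}" and p: "l \<le> p" "p \<le> u"
    and "\<And>y. y \<in> {l..p} \<Longrightarrow> A \<le> g y" "\<And>y. y \<in> {p..u} \<Longrightarrow> B \<le> g y"
  shows "A * (p - l) + B * (u - p) \<le> I"
proof -
  have io: "g integrable_on {l..u}" using g by blast
  have 1: "g integrable_on {l..p}" and 2: "g integrable_on {p..u}"
    using io p by (auto intro: integrable_on_subinterval)
  have "A * (p - l) \<le> integral {l..p} g"
    using has_integral_le[OF has_integral_const_real[of A l p] integrable_integral[OF 1]] assms by (simp add: mult.commute)
  moreover have "B * (u - p) \<le> integral {p..u} g"
    using has_integral_le[OF has_integral_const_real[of B p u] integrable_integral[OF 2]] assms by (simp add: mult.commute)
  moreover have "integral {l..p} g + integral {p..u} g = I"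
    using Henstock_Kurzweil_Integration.integral_combine[OF p io] g integral_unique by metis
  ultimately show ?thesis by linarith
qed

lemma has_integral_step_upper:
  fixes g :: "real \<Rightarrow> real"
  assumes "(g has_integral I) {l..u}" and "l \<le> p" "p \<le> u"
    and "\<And>y. y \<in> {l..p} \<Longrightarrow> g y \<le> A" "\<And>y. y \<in> {p..u} \<Longrightarrow> g y \<le> B"
  shows "I \<le> A * (p - l) + B * (u - p)"
  using has_integral_step_lower[OF has_integral_neg[OF assms(1)] assms(2,3), of "- A" "- B"] assms(4,5)
  by simp

text \<open>The step equal to \<alpha> on length \<open>l\<close> and \<beta> on length
  \<open>2 - l\<close> has integral \<open>2 * r\<close>. A layer on the wrong side of
  \<open>x\<close> shifts the integral by at least \<beta> - \<alpha> times the distance of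
  \<open>x\<close> from the jump, up to the height error \<open>2 * \<eta>\<close> and the layer
  width \<open>\<epsilon> * T\<close>; \<open>small\<close> says that these errors cannot
  compensate.\<close>

lemma layer_location:
  fixes z :: "real \<Rightarrow> real"
  assumes "\<alpha> < \<beta>" "\<eta> > 0" "\<epsilon> > 0" "T \<ge> 0"
    and mono: "mono_on {-1/\<epsilon>..1/\<epsilon>} z"
    and bounds: "\<And>y. y \<in> {-1/\<epsilon>..1/\<epsilon>} \<Longrightarrow> \<alpha> - \<eta> \<le> z y \<and> z y \<le> \<beta> + \<eta>"
    and int: "(z has_integral (2 * r / \<epsilon>)) {-1/\<epsilon>..1/\<epsilon>}"
    and layer: "\<And>s t. -1/\<epsilon> \<le> s \<Longrightarrow> s \<le> t \<Longrightarrow> t \<le> 1/\<epsilon> \<Longrightarrow> \<alpha> + \<eta> < z s \<Longrightarrow> z t < \<beta> - \<eta> \<Longrightarrow> t - s < T"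
    and r: "r = (\<alpha> * l + \<beta> * (2 - l)) / 2" "0 < l" "l < 2"
    and x: "x \<in> {-1..1}"
    and small: "2 * \<eta> + \<epsilon> * T * (\<beta> - \<alpha>) < (\<beta> - \<alpha>) * \<bar>x + 1 - l\<bar>"
  shows "\<bar>z (x/\<epsilon>) - (if x \<le> -1 + l then \<alpha> else \<beta>)\<bar> \<le> \<eta>"
proof -
  have X: "x/\<epsilon> \<in> {-1/\<epsilon>..1/\<epsilon>}" using x \<open>\<epsilon> > 0\<close> by (simp add: field_simps)
  \<comment> \<open>The layer width is below the distance to the jump, which keeps the splitting
    points \<open>p\<close> inside the interval.\<close>
  have "\<epsilon> * T * (\<beta> - \<alpha>) < \<bar>x + 1 - l\<bar> * (\<beta> - \<alpha>)"
    using small \<open>\<eta> > 0\<close> by (simp add: mult.commute)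
  then have T: "\<epsilon> * T < \<bar>x + 1 - l\<bar>" using \<open>\<alpha> < \<beta>\<close> by simp
  have int_r: "2 * r = \<alpha> * l + \<beta> * (2 - l)" using r by simp
  show ?thesis
  proof (cases "x \<le> -1 + l")
    case True
    have "z (x/\<epsilon>) \<le> \<alpha> + \<eta>"
    proof (rule ccontr)
      assume *: "\<not> z (x/\<epsilon>) \<le> \<alpha> + \<eta>"
      \<comment> \<open>If \<open>z\<close> has left the lower phase at \<open>x/\<epsilon>\<close>,
        then from \<open>p\<close> on it is at least \<open>\<beta> - \<eta>\<close>, since a layer
        is shorter than \<open>T\<close>.\<close>
      define p where "p = x/\<epsilon> + T"
      have p: "-1/\<epsilon> \<le> p" "x/\<epsilon> \<le> p" using X \<open>T \<ge> 0\<close> by (auto simp: p_def)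
      have p': "p \<le> 1/\<epsilon>"
      proof -
        have "x + \<epsilon> * T \<le> 1" using T True r by simp
        then have "(x + \<epsilon> * T) / \<epsilon> \<le> 1/\<epsilon>" using \<open>\<epsilon> > 0\<close> by (intro divide_right_mono) auto
        then show ?thesis using \<open>\<epsilon> > 0\<close> by (simp add: p_def add_divide_distrib)
      qed
      have scaled: "(p - -1/\<epsilon>) * \<epsilon> = x + \<epsilon> * T + 1" "(1/\<epsilon> - p) * \<epsilon> = 1 - x - \<epsilon> * T"
        using \<open>\<epsilon> > 0\<close> by (simp_all add: p_def algebra_simps)
      have "(\<alpha> - \<eta>) * (p - -1/\<epsilon>) + (\<beta> - \<eta>) * (1/\<epsilon> - p) \<le> 2 * r / \<epsilon>"
      proof (rule has_integral_step_lower[OF int p(1) p'])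
        show "\<alpha> - \<eta> \<le> z y" if "y \<in> {- 1 / \<epsilon>..p}" for y using bounds[of y] that p' by auto
        show "\<beta> - \<eta> \<le> z y" if "y \<in> {p..1/\<epsilon>}" for y
          using layer[of "x/\<epsilon>" y] that p X * unfolding p_def by force
      qed
      then have "((\<alpha> - \<eta>) * (p - -1/\<epsilon>) + (\<beta> - \<eta>) * (1/\<epsilon> - p)) * \<epsilon> \<le> 2 * r / \<epsilon> * \<epsilon>"
        using \<open>\<epsilon> > 0\<close> by (intro mult_right_mono) auto
      then have "(\<alpha> - \<eta>) * (x + \<epsilon> * T + 1) + (\<beta> - \<eta>) * (1 - x - \<epsilon> * T) \<le> 2 * r"
        unfolding distrib_right mult.assoc using scaled \<open>\<epsilon> > 0\<close> by simp
      \<comment> \<open>The lower bound exceeds \<open>2 * r\<close> by \<open>(\<beta> - \<alpha>)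
        * (l - x - 1 - \<epsilon> * T) - 2 * \<eta>\<close>, which is positive.\<close>
      then show False using small True unfolding int_r by (simp add: algebra_simps)
    qed
    then show ?thesis using bounds[OF X] True by auto
  next
    case False
    have "z (x/\<epsilon>) \<ge> \<beta> - \<eta>"
    proof (rule ccontr)
      assume *: "\<not> z (x/\<epsilon>) \<ge> \<beta> - \<eta>"
      \<comment> \<open>The mirrored argument: up to \<open>p\<close> the profile is still at most
        \<open>\<alpha> + \<eta>\<close>, so the integral is too small.\<close>
      define p where "p = x/\<epsilon> - T"
      have p: "p \<le> 1/\<epsilon>" "p \<le> x/\<epsilon>" using X \<open>T \<ge> 0\<close> by (auto simp: p_def)
      have p': "-1/\<epsilon> \<le> p"
      proof -
        have "-1 \<le> x - \<epsilon> * T" using T False r by simp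
        then have "-1/\<epsilon> \<le> (x - \<epsilon> * T) / \<epsilon>" using \<open>\<epsilon> > 0\<close> by (intro divide_right_mono) auto
        then show ?thesis using \<open>\<epsilon> > 0\<close> by (simp add: p_def diff_divide_distrib)
      qed
      have scaled: "(p - -1/\<epsilon>) * \<epsilon> = x - \<epsilon> * T + 1" "(1/\<epsilon> - p) * \<epsilon> = 1 - x + \<epsilon> * T"
        using \<open>\<epsilon> > 0\<close> by (simp_all add: p_def algebra_simps)
      have "2 * r / \<epsilon> \<le> (\<alpha> + \<eta>) * (p - -1/\<epsilon>) + (\<beta> + \<eta>) * (1/\<epsilon> - p)"
      proof (rule has_integral_step_upper[OF int p' p(1)])
        show "z y \<le> \<alpha> + \<eta>" if "y \<in> {- 1 / \<epsilon>..p}" for y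
          using layer[of y "x/\<epsilon>"] that p X * unfolding p_def by force
        show "z y \<le> \<beta> + \<eta>" if "y \<in> {p..1/\<epsilon>}" for y using bounds[of y] that p' by auto
      qed
      then have "2 * r / \<epsilon> * \<epsilon> \<le> ((\<alpha> + \<eta>) * (p - -1/\<epsilon>) + (\<beta> + \<eta>) * (1/\<epsilon> - p)) * \<epsilon>"
        using \<open>\<epsilon> > 0\<close> by (intro mult_right_mono) auto
      then have "2 * r \<le> (\<alpha> + \<eta>) * (x - \<epsilon> * T + 1) + (\<beta> + \<eta>) * (1 - x + \<epsilon> * T)"
        unfolding distrib_right mult.assoc using scaled \<open>\<epsilon> > 0\<close> by simp
      then show False using small False unfolding int_r by (simp add: algebra_simps)
    qed
    then show ?thesis using bounds[OF X] False by auto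
  qed
qed

section \<open>The Maxwell solution\<close>

lemma maxwell_solution_tendsto:
  assumes mx: "maxwell_solution F al be z D" and r: "r \<in> {alpha0 F al be<..<beta0 F al be}"
  shows "\<forall>\<^sub>F \<epsilon> in at_right 0. simple_solution F al be \<epsilon> r (z \<epsilon> r) (D \<epsilon> r)"
    and "((\<lambda>\<epsilon>. D \<epsilon> r) \<longlongrightarrow> Delta0 F al be) (at_right 0)"
    and "((\<lambda>\<epsilon>. z1 F al be (D \<epsilon> r)) \<longlongrightarrow> alpha0 F al be) (at_right 0)"
    and "((\<lambda>\<epsilon>. z2 F al be (D \<epsilon> r)) \<longlongrightarrow> beta0 F al be) (at_right 0)"
proof -
  define a where "a = alpha0 F al be"
  define b where "b = beta0 F al be"
  \<comment> \<open>Half the distance from \<open>r\<close> to the nearer phase: it puts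
    \<open>r\<close> in the allowed range and keeps \<delta> strictly below
    \<open>(b - a) / 2\<close>.\<close>
  define \<delta> where "\<delta> = min (r - a) (b - r) / 2"
  have rd: "r \<in> {a + \<delta>..b - \<delta>}" and \<delta>: "\<delta> \<in> {0<..<(b - a) / 2}"
    using r by (auto simp: \<delta>_def a_def b_def min_def field_simps)
  note M = mx[unfolded maxwell_solution_def, folded a_def b_def, rule_format, OF \<delta>]
  from conjunct1[OF M] obtain e where e: "e > 0"
    "\<And>\<epsilon>. \<epsilon> \<in> {0<..<e} \<Longrightarrow> simple_solution F al be \<epsilon> r (z \<epsilon> r) (D \<epsilon> r)"
    using rd by blast
  show "\<forall>\<^sub>F \<epsilon> in at_right 0. simple_solution F al be \<epsilon> r (z \<epsilon> r) (D \<epsilon> r)"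
    using eventually_at_right_real[OF e(1)] by eventually_elim (rule e(2))
  from conjunct2[OF M] obtain C K where "C > 0" and
    ev: "\<forall>\<^sub>F \<epsilon> in at_right 0. \<forall>r\<in>{a + \<delta>..b - \<delta>}.
           norm (D \<epsilon> r - Delta0 F al be) \<le> K * exp (- C / \<epsilon>) \<and>
           \<bar>z1 F al be (D \<epsilon> r) - a\<bar> \<le> K * exp (- C / \<epsilon>) \<and>
           \<bar>z2 F al be (D \<epsilon> r) - b\<bar> \<le> K * exp (- C / \<epsilon>)"
    by blast
  have lim: "((\<lambda>\<epsilon>. K * exp (- C / \<epsilon>)) \<longlongrightarrow> 0) (at_right 0)"
    using \<open>C > 0\<close> by real_asymp
  have "((\<lambda>\<epsilon>. D \<epsilon> r - Delta0 F al be) \<longlongrightarrow> 0) (at_right 0)"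
    by (rule Lim_null_comparison[OF _ lim], rule eventually_mono[OF ev]) (use rd in blast)
  then show "((\<lambda>\<epsilon>. D \<epsilon> r) \<longlongrightarrow> Delta0 F al be) (at_right 0)" by (rule LIM_zero_cancel)
  have "((\<lambda>\<epsilon>. z1 F al be (D \<epsilon> r) - a) \<longlongrightarrow> 0) (at_right 0)"
    by (rule Lim_null_comparison[OF _ lim], rule eventually_mono[OF ev]) (use rd in auto)
  then show "((\<lambda>\<epsilon>. z1 F al be (D \<epsilon> r)) \<longlongrightarrow> alpha0 F al be) (at_right 0)"
    unfolding a_def by (rule LIM_zero_cancel)
  have "((\<lambda>\<epsilon>. z2 F al be (D \<epsilon> r) - b) \<longlongrightarrow> 0) (at_right 0)"
    by (rule Lim_null_comparison[OF _ lim], rule eventually_mono[OF ev]) (use rd in auto)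
  then show "((\<lambda>\<epsilon>. z2 F al be (D \<epsilon> r)) \<longlongrightarrow> beta0 F al be) (at_right 0)"
    unfolding b_def by (rule LIM_zero_cancel)
qed

text \<open>The equality of the two wells is read off in the limit from the levels of the solutions
  at \<open>z\<^sub>1\<close> and \<open>z\<^sub>2\<close>; this avoids showing that the description defining \<^const>\<open>sigma0\<close> is proper.\<close>

lemma maxwell_Phi_gt:
  assumes tp: "two_phase F al be" and mx: "maxwell_solution F al be z D"
    and r: "r \<in> {alpha0 F al be<..<beta0 F al be}"
    and t: "alpha0 F al be < t" "t < beta0 F al be"
  shows "alpha0 F al be > 0" "b0 F al be < Phi F (sigma0 F al be) t"
proof -
  note M = maxwell_solution_tendsto[OF mx r]
  define \<sigma> where "\<sigma> \<epsilon> = fst (D \<epsilon> r)" for \<epsilon>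
  define b where "b \<epsilon> = snd (D \<epsilon> r)" for \<epsilon>
  have Deq: "D \<epsilon> r = (\<sigma> \<epsilon>, b \<epsilon>)" for \<epsilon> by (simp add: \<sigma>_def b_def)
  have ls: "(\<sigma> \<longlongrightarrow> sigma0 F al be) (at_right 0)" and lb: "(b \<longlongrightarrow> b0 F al be) (at_right 0)"
    using tendsto_fst[OF M(2)] tendsto_snd[OF M(2)] by (simp_all add: \<sigma>_def[abs_def] b_def[abs_def] Delta0_def)
  have ev: "\<forall>\<^sub>F \<epsilon> in at_right 0. \<sigma> \<epsilon> \<in> {sigma_lo F be..sigma_hi F al} \<and>
      Phi F (\<sigma> \<epsilon>) (z2 F al be (D \<epsilon> r)) = b \<epsilon>"
    using M(1) eventually_at_right_less[of "0::real"]
  proof eventually_elim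
    case (elim \<epsilon>)
    then show ?case using z_levels[OF tp elim(1)[unfolded Deq]]
      by (auto simp: Deq simple_solution_def admissible_def)
  qed
  \<comment> \<open>Admissible values of \<sigma> converge to \<open>sigma0\<close>, so it lies in
    the closed range, where the critical points are well defined.\<close>
  have s0: "sigma0 F al be \<in> {sigma_lo F be..sigma_hi F al}"
    by (rule Lim_in_closed_set[OF _ _ _ ls])
       (use ev in \<open>auto simp: eventually_conj_iff\<close>)
  have a: "alpha0 F al be > 0" "beta0 F al be > 0"
    using alpha_crit[OF tp s0] beta_crit[OF tp s0] tp by (auto simp: alpha0_def beta0_def two_phase_def)
  then show "alpha0 F al be > 0" by blast
  \<comment> \<open>The same quantity has two limits: the energy at \<open>beta0\<close>, by
    continuity, and \<open>b0\<close>, because it equals \<open>b \<epsilon>\<close>. Hence the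
    wells have equal height.\<close>
  have "((\<lambda>\<epsilon>. Phi F (\<sigma> \<epsilon>) (z2 F al be (D \<epsilon> r))) \<longlongrightarrow> Phi F (sigma0 F al be) (beta0 F al be)) (at_right 0)"
    unfolding Phi_def
    by (intro tendsto_intros isCont_tendsto_compose[OF two_phase_isCont(1)[OF tp]] M(4) ls a)
  moreover have "((\<lambda>\<epsilon>. Phi F (\<sigma> \<epsilon>) (z2 F al be (D \<epsilon> r))) \<longlongrightarrow> b0 F al be) (at_right 0)"
    using lb by (rule Lim_transform_eventually) (use ev in \<open>auto elim: eventually_mono\<close>)
  ultimately have "Phi F (sigma0 F al be) (beta0 F al be) = b0 F al be"
    using tendsto_unique trivial_limit_at_right_real by blast
  then show "b0 F al be < Phi F (sigma0 F al be) t"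
    using t by (intro Phi_gt_between_wells[OF tp s0]) (auto simp: b0_def alpha0_def beta0_def)
qed

text \<open>Compactness gives a positive minimum of the gap at the Maxwell point; convergence of the
  pair costs at most half of it.\<close>

lemma maxwell_Phi_bound:
  assumes tp: "two_phase F al be" and mx: "maxwell_solution F al be z D"
    and r: "r \<in> {alpha0 F al be<..<beta0 F al be}" and "\<eta> > 0"
  obtains c where "c > 0"
    "\<forall>\<^sub>F \<epsilon> in at_right 0. \<forall>v\<in>{alpha0 F al be + \<eta>..beta0 F al be - \<eta>}.
       c \<le> Phi F (fst (D \<epsilon> r)) v - snd (D \<epsilon> r)"
proof -
  let ?S = "{alpha0 F al be + \<eta>..beta0 F al be - \<eta>}"
  let ?s = "sigma0 F al be" and ?b = "b0 F al be" and ?be = "beta0 F al be"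
  have ap: "alpha0 F al be > 0" using maxwell_Phi_gt(1)[OF tp mx r, of r] r by auto
  have gt: "?b < Phi F ?s t" if "t \<in> ?S" for t
    using maxwell_Phi_gt(2)[OF tp mx r, of t] that \<open>\<eta> > 0\<close> by auto
  have "\<exists>m>0. \<forall>v\<in>?S. m \<le> Phi F ?s v - ?b"
  \<comment> \<open>For large \<eta> the set is empty and any positive constant serves.\<close>
  proof (cases "?S = {}")
    case False
    have "continuous_on ?S (\<lambda>v. Phi F ?s v - ?b)"
      using ap \<open>\<eta> > 0\<close>
      by (intro continuous_intros continuous_at_imp_continuous_on ballI)
         (auto intro!: DERIV_isCont[OF Phi_deriv[OF tp]])
    from continuous_attains_inf[OF compact_Icc False this] obtain w where
      "w \<in> ?S" "\<forall>v\<in>?S. Phi F ?s w - ?b \<le> Phi F ?s v - ?b" by blast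
    then show ?thesis using gt[of w] by (intro exI[of _ "Phi F ?s w - ?b"]) auto
  qed (auto intro: exI[of _ 1])
  then obtain m where m: "m > 0" "\<And>v. v \<in> ?S \<Longrightarrow> m \<le> Phi F ?s v - ?b" by blast
  note lim = maxwell_solution_tendsto(2)[OF mx r]
  \<comment> \<open>The energy is affine in \<sigma> with slope \<open>- v\<close>, and
    \<open>v\<close> is at most \<open>beta0\<close>, so this quantity bounds the change of the gap
    uniformly in \<open>v\<close>.\<close>
  have "((\<lambda>\<epsilon>. \<bar>fst (D \<epsilon> r) - ?s\<bar> * ?be + \<bar>snd (D \<epsilon> r) - ?b\<bar>) \<longlongrightarrow> \<bar>?s - ?s\<bar> * ?be + \<bar>?b - ?b\<bar>) (at_right 0)"
    using tendsto_fst[OF lim] tendsto_snd[OF lim]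
    by (intro tendsto_intros) (simp_all add: Delta0_def)
  then have "\<forall>\<^sub>F \<epsilon> in at_right 0. \<bar>fst (D \<epsilon> r) - ?s\<bar> * ?be + \<bar>snd (D \<epsilon> r) - ?b\<bar> < m / 2"
    using m(1) by (intro order_tendstoD(2)) auto
  then have "\<forall>\<^sub>F \<epsilon> in at_right 0. \<forall>v\<in>?S. m / 2 \<le> Phi F (fst (D \<epsilon> r)) v - snd (D \<epsilon> r)"
  proof (rule eventually_mono, intro ballI)
    fix \<epsilon> v
    assume elim: "\<bar>fst (D \<epsilon> r) - ?s\<bar> * ?be + \<bar>snd (D \<epsilon> r) - ?b\<bar> < m / 2" "v \<in> ?S"
    have "\<bar>(fst (D \<epsilon> r) - ?s) * v\<bar> \<le> \<bar>fst (D \<epsilon> r) - ?s\<bar> * ?be"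
      using elim(2) ap \<open>\<eta> > 0\<close> by (auto simp: abs_mult intro!: mult_left_mono)
    moreover have "Phi F (fst (D \<epsilon> r)) v = Phi F ?s v - (fst (D \<epsilon> r) - ?s) * v"
      by (simp add: Phi_def algebra_simps)
    ultimately show "m / 2 \<le> Phi F (fst (D \<epsilon> r)) v - snd (D \<epsilon> r)"
      using m(2)[OF elim(2)] elim(1) by linarith
  qed
  then show ?thesis using that[of "m / 2"] m(1) by auto
qed

lemma maxwell_rescaled_tendsto:
  assumes tp: "two_phase F al be" and mx: "maxwell_solution F al be z D"
    and r: "r \<in> {alpha0 F al be<..<beta0 F al be}" and x: "x \<in> {-1..1}"
    and xl: "x \<noteq> -1 + ell1 F al be r"
  shows "((\<lambda>\<epsilon>. rescaled z \<epsilon> r x) \<longlongrightarrow> u0 F al be r x) (at_right 0)"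
proof (rule tendstoI)
  fix e :: real assume "e > 0"
  define \<alpha> \<beta> l where "\<alpha> = alpha0 F al be" and "\<beta> = beta0 F al be" and "l = ell1 F al be r"
  have ab: "\<alpha> < r" "r < \<beta>" using r by (auto simp: \<alpha>_def \<beta>_def)
  have l: "l = 2 * (\<beta> - r) / (\<beta> - \<alpha>)" by (simp add: l_def ell1_def \<alpha>_def \<beta>_def)
  have l': "0 < l" "l < 2" "l * (\<beta> - \<alpha>) = 2 * (\<beta> - r)"
    using ab unfolding l by (simp_all add: divide_less_eq)
  \<comment> \<open>The shift of the integral caused by misplacing the jump, positive because
    \<open>x\<close> is not the jump point.\<close>
  define g where "g = (\<beta> - \<alpha>) * \<bar>x + 1 - l\<bar>"
  have g: "g > 0" using xl ab by (auto simp: g_def l_def)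
  \<comment> \<open>The first entry meets the accuracy \<open>e\<close>; the second leaves at least
    \<open>g / 2\<close> for the layer width.\<close>
  define \<eta> where "\<eta> = min (e / 2) (g / 4)"
  have \<eta>: "\<eta> > 0" "\<eta> < e" "2 * \<eta> < g" using \<open>e > 0\<close> g by (auto simp: \<eta>_def)
  obtain c where c: "c > 0" "\<forall>\<^sub>F \<epsilon> in at_right 0. \<forall>v\<in>{\<alpha> + \<eta>..\<beta> - \<eta>}.
       c \<le> Phi F (fst (D \<epsilon> r)) v - snd (D \<epsilon> r)"
    using maxwell_Phi_bound[OF tp mx r \<eta>(1)] unfolding \<alpha>_def \<beta>_def by blast
  \<comment> \<open>The time to climb \<beta> - \<alpha> at speed \<open>sqrt (2 * c)\<close>,
    independent of \<epsilon>.\<close>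
  define T where "T = (\<beta> - \<alpha>) / sqrt (2 * c)"
  have T: "T > 0" "sqrt (2 * c) * T = \<beta> - \<alpha>" using c ab by (auto simp: T_def)
  note M = maxwell_solution_tendsto[OF mx r, folded \<alpha>_def \<beta>_def]
  have "((\<lambda>\<epsilon>. 2 * \<eta> + \<epsilon> * T * (\<beta> - \<alpha>)) \<longlongrightarrow> 2 * \<eta> + 0 * T * (\<beta> - \<alpha>)) (at_right 0)"
    by (intro tendsto_intros)
  then have sm: "\<forall>\<^sub>F \<epsilon> in at_right 0. 2 * \<eta> + \<epsilon> * T * (\<beta> - \<alpha>) < g"
    using \<eta> by (intro order_tendstoD(2)) auto
  have e1: "\<forall>\<^sub>F \<epsilon> in at_right 0. \<alpha> - \<eta> < z1 F al be (D \<epsilon> r)"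
    using M(3) \<eta> by (intro order_tendstoD(1)) auto
  have e2: "\<forall>\<^sub>F \<epsilon> in at_right 0. z2 F al be (D \<epsilon> r) < \<beta> + \<eta>"
    using M(4) \<eta> by (intro order_tendstoD(2)) auto
  show "\<forall>\<^sub>F \<epsilon> in at_right 0. dist (rescaled z \<epsilon> r x) (u0 F al be r x) < e"
    using c(2) sm e1 e2 M(1) eventually_at_right_less[of "0::real"]
  proof eventually_elim
    case (elim \<epsilon>)
    note ss = elim(5)
    obtain \<sigma> b where D: "D \<epsilon> r = (\<sigma>, b)" by (cases "D \<epsilon> r")
    have mono: "mono_on {-1/\<epsilon>..1/\<epsilon>} (z \<epsilon> r)"
      using ss by (auto simp: simple_solution_def D)
    have ep: "-1/\<epsilon> \<le> 1/\<epsilon>" using elim(6) by (simp add: field_simps)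
    note ends = simple_solution_endpoints[OF tp ss elim(6)]
    have "\<bar>z \<epsilon> r (x/\<epsilon>) - (if x \<le> -1 + l then \<alpha> else \<beta>)\<bar> \<le> \<eta>"
    proof (rule layer_location[where r = r and T = T])
      show "\<alpha> - \<eta> \<le> z \<epsilon> r y \<and> z \<epsilon> r y \<le> \<beta> + \<eta>" if "y \<in> {-1/\<epsilon>..1/\<epsilon>}" for y
        using mono_onD[OF mono, of "-1/\<epsilon>" y] mono_onD[OF mono, of y "1/\<epsilon>"] that ends elim ep by force
      show "(z \<epsilon> r has_integral 2 * r / \<epsilon>) {-1/\<epsilon>..1/\<epsilon>}"
        using ss by (auto simp: simple_solution_def D bvp_solution_def)
      show "t - s < T" if st: "-1/\<epsilon> \<le> s" "s \<le> t" "t \<le> 1/\<epsilon>" "\<alpha> + \<eta> < z \<epsilon> r s" "z \<epsilon> r t < \<beta> - \<eta>" for s t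
      proof -
        have "sqrt (2 * c) * (t - s) \<le> z \<epsilon> r t - z \<epsilon> r s"
          using elim(1) D st c(1)
          by (intro simple_solution_growth[OF ss[unfolded D] elim(6) _ st(1-3)]) auto
        also have "\<dots> < sqrt (2 * c) * T" using st \<eta> T by simp
        finally show ?thesis using c(1) by simp
      qed
      show "r = (\<alpha> * l + \<beta> * (2 - l)) / 2" using l'(3) by (simp add: algebra_simps)
    qed (use ab \<eta> elim T l' mono x in \<open>auto simp: g_def\<close>)
    then show ?case
      using \<eta>(2) by (simp add: dist_real_def rescaled_def u0_def flip: \<alpha>_def \<beta>_def l_def split: if_splits)
  qed
qed

text \<open>Says that reflection about 0 exchanges the jump points \<open>-1 + ell1\<close> and
  \<open>-1 + ell2\<close>.\<close>

lemma ell1_add_ell2: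
  assumes "alpha0 F al be < beta0 F al be"
  shows "ell1 F al be r + ell2 F al be r = 2"
  using assms by (simp add: ell1_def ell2_def flip: add_divide_distrib) (simp add: divide_eq_eq)

theorem theorem7:
  fixes F :: "real \<Rightarrow> real" and al be :: real
    and z :: "real \<Rightarrow> real \<Rightarrow> real \<Rightarrow> real" and D :: "real \<Rightarrow> real \<Rightarrow> real \<times> real"
    and r x :: real
  assumes "two_phase F al be"
    and "maxwell_solution F al be z D"
    and "r \<in> {alpha0 F al be<..<beta0 F al be}"
    and "x \<in> {-1..1}"
  shows "(x \<noteq> -1 + ell1 F al be r \<longrightarrow>
            ((\<lambda>\<epsilon>. rescaled z \<epsilon> r x) \<longlongrightarrow> u0 F al be r x) (at_right 0)) \<and>
         (x \<noteq> -1 + ell2 F al be r \<longrightarrow>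
            ((\<lambda>\<epsilon>. rescaled_reversed z \<epsilon> r x) \<longlongrightarrow> u0 F al be r (-x)) (at_right 0))"
proof (intro conjI impI)
  show "((\<lambda>\<epsilon>. rescaled z \<epsilon> r x) \<longlongrightarrow> u0 F al be r x) (at_right 0)" if "x \<noteq> -1 + ell1 F al be r"
    using maxwell_rescaled_tendsto assms that by blast
  show "((\<lambda>\<epsilon>. rescaled_reversed z \<epsilon> r x) \<longlongrightarrow> u0 F al be r (-x)) (at_right 0)"
    if "x \<noteq> -1 + ell2 F al be r"
    \<comment> \<open>The reversed profile at \<open>x\<close> is the original at \<open>-x\<close>,
      and \<open>-x\<close> avoids \<open>-1 + ell1\<close> because the two lengths add up to
      2.\<close>
    unfolding rescaled_reversed_def
    using assms that ell1_add_ell2[of F al be r]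
    by (intro maxwell_rescaled_tendsto) auto
qed

end
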